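(* Let $t\geq s\geq 3$ be integers, let $H$ be a graph, and let $K\geq \left(R(H,K_t)\right)^{2/s}R(H,K_s)$. If $G$ is an $H$-free graph of order $n$ with \[ \lambda(G)\geq K n^{1-1/s}, \] then $G$ contains an induced copy of $K_{s,t}$.
   Context: All graphs are finite and simple. $\lambda(G)$ denotes the largest eigenvalue of the adjacency matrix of $G$. A graph is $H$-free if it contains no subgraph (not necessarily induced) isomorphic to $H$. For graphs $H$ and $F$, the Ramsey number $R(H,F)$ is the smallest integer $N$ such that every graph on $N$ vertices contains a subgraph isomorphic to $H$ or its complement contains a subgraph isomorphic to $F$; in particular $R(H,K_t)$ is the least $N$ such that every $N$-vertex graph contains a copy of $H$ or an independent set of size $t$. An induced copy of $K_{s,t}$ is an induced subgraph isomorphic to the complete bipartite graph $K_{s,t}$. *)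

theory Defs
  imports
    Graph_Theory.Graph_Theory
    Jordan_Normal_Form.Spectral_Radius
begin

text \<open>
  Finite simple graphs are the symmetric, loop-free, finite pair digraphs
  (\<^locale>\<open>pair_graph\<close>): each edge is represented by its two orientations.
  The null graph is allowed.
\<close>

text \<open>A (not necessarily induced) subgraph of \<open>G\<close> that is isomorphic to \<open>H\<close>.\<close>

definition contains_copy :: "'b pair_pre_digraph \<Rightarrow> 'a pair_pre_digraph \<Rightarrow> bool" where
  "contains_copy H G \<longleftrightarrow>
     (\<exists>F. subgraph F (with_proj G) \<and> digraph_iso (with_proj H) F)"

definition free_of :: "'b pair_pre_digraph \<Rightarrow> 'a pair_pre_digraph \<Rightarrow> bool" where
  "free_of H G \<longleftrightarrow> \<not> contains_copy H G"

definition contains_induced_complete_bipartite ::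
    "nat \<Rightarrow> nat \<Rightarrow> 'a pair_pre_digraph \<Rightarrow> bool" where
  "contains_induced_complete_bipartite s t G \<longleftrightarrow>
     (\<exists>F. induced_subgraph F (with_proj G) \<and> K\<^bsub>s,t\<^esub> F)"

definition graph_complement :: "'a pair_pre_digraph \<Rightarrow> 'a pair_pre_digraph" where
  "graph_complement G = \<lparr> pverts = pverts G,
     parcs = {(u, v). u \<in> pverts G \<and> v \<in> pverts G \<and> u \<noteq> v \<and> (u, v) \<notin> parcs G} \<rparr>"

definition complete_graph :: "nat \<Rightarrow> nat pair_pre_digraph" where
  "complete_graph n = \<lparr> pverts = {..<n}, parcs = {(u, v). u < n \<and> v < n \<and> u \<noteq> v} \<rparr>"

lemma complete_graph_is_complete: "K\<^bsub>n\<^esub> (with_proj (complete_graph n))"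
  by (auto simp: complete_digraph_pair_def complete_graph_def)

text \<open>
  Every finite graph is isomorphic to one whose vertices are natural numbers, so
  quantifying over the latter covers all graphs on \<open>N\<close> vertices.
\<close>

definition ramsey_number :: "'a pair_pre_digraph \<Rightarrow> 'b pair_pre_digraph \<Rightarrow> nat" where
  "ramsey_number H F = (LEAST N. \<forall>G :: nat pair_pre_digraph.
     pair_graph G \<and> card (pverts G) = N \<longrightarrow>
       contains_copy H G \<or> contains_copy F (graph_complement G))"

text \<open>
  The adjacency matrix is taken with respect to an arbitrary enumeration of the vertices.
  Another enumeration conjugates it by a permutation matrix and so leaves the spectrum
  unchanged.
\<close>

definition adjacency_matrix :: "'a pair_pre_digraph \<Rightarrow> real mat" where
  "adjacency_matrix G =
     (let vs = (SOME vs. distinct vs \<and> set vs = pverts G)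
      in mat (length vs) (length vs)
           (\<lambda>(i, j). if (vs ! i, vs ! j) \<in> parcs G then 1 else 0))"

text \<open>Only meaningful for a nonempty vertex set: a \<open>0 \<times> 0\<close> matrix has no eigenvalues.\<close>

definition largest_eigenvalue :: "'a pair_pre_digraph \<Rightarrow> real" where
  "largest_eigenvalue G = Max (spectrum (adjacency_matrix G))"

end

theory Submission
  imports Defs "HOL-Library.Ramsey"
begin

text \<open>
  Write \<open>m = R(H, K\<^sub>s)\<close> and \<open>r = R(H, K\<^sub>t)\<close>. It suffices to find an independent \<open>s\<close>-set with at
  least \<open>r\<close> common neighbours, because these contain an independent \<open>t\<close>-set. The absolute
  values of an eigenvector, scaled to maximum 1, give weights \<open>x\<close> with
  \<open>\<lambda> x\<^sub>v \<le> W\<^sub>v\<close>, where \<open>W\<^sub>v\<close> is the total weight of the neighbours of \<open>v\<close>. Every \<open>m\<close>-set contains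
  an independent \<open>s\<close>-set, so averaging shows that the independent \<open>s\<close>-sets inside the
  neighbourhood of \<open>v\<close> have total weight at least \<open>(W\<^sub>v / m)\<^sup>s - 1\<close>, a set being weighted by the
  product of its vertex weights. If all independent \<open>s\<close>-sets had fewer than \<open>r\<close> common
  neighbours, summing over \<open>v\<close> would give
  \<open>\<Sum>\<^sub>v W\<^sub>v\<^sup>s \<le> m\<^sup>s ((r - 1) X\<^sup>s + n)\<close> for the total weight \<open>X \<ge> \<lambda>\<close>. By the power mean
  inequality the left-hand side is at least \<open>\<lambda>\<^sup>s X\<^sup>s / n\<^sup>s\<^sup>-\<^sup>1 \<ge> m\<^sup>s r\<^sup>2 X\<^sup>s\<close>, a contradiction.
\<close>

section \<open>Weighted counting\<close>

text \<open>A convex function lies above its tangent at \<open>a\<close>. For \<open>a > 0\<close>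
  this is Bernoulli's inequality at \<open>y / a - 1\<close>, scaled by
  \<open>a ^ s\<close>.\<close>

lemma power_tangent_le:
  fixes a y :: real
  assumes "0 \<le> a" "0 \<le> y" "0 < s"
  shows "a ^ s + real s * a ^ (s - 1) * (y - a) \<le> y ^ s"
proof (cases "a = 0")
  case True
  then show ?thesis
    using assms by (cases "s = 1") (auto simp: power_0_left)
next
  case False
  with assms have a: "a > 0" by simp
  have "1 + real s * (y / a - 1) \<le> (1 + (y / a - 1)) ^ s"
    by (rule Bernoulli_inequality) (use assms a in auto)
  then have "a ^ s * (1 + real s * (y / a - 1)) \<le> a ^ s * (y / a) ^ s"
    using a by (intro mult_left_mono) auto
  also have "\<dots> = y ^ s"
    using a by (simp add: power_divide)
  also have "a ^ s * (1 + real s * (y / a - 1)) = a ^ s + real s * a ^ (s - 1) * (y - a)"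
    using a \<open>0 < s\<close> by (cases s) (auto simp: field_simps)
  finally show ?thesis .
qed

text \<open>Summing the tangent inequalities at the mean \<open>a\<close> of the values makes the
  linear terms cancel.\<close>

lemma power_sum_le_card_power_sum:
  fixes x :: "'a \<Rightarrow> real"
  assumes "finite V" "\<And>v. v \<in> V \<Longrightarrow> 0 \<le> x v" "0 < s"
  shows "(\<Sum>v\<in>V. x v) ^ s \<le> real (card V) ^ (s - 1) * (\<Sum>v\<in>V. x v ^ s)"
proof (cases "V = {}")
  case True
  then show ?thesis using assms by (simp add: power_0_left)
next
  case False
  define n where "n = real (card V)"
  define a where "a = (\<Sum>v\<in>V. x v) / n"
  have n: "n > 0" using assms False by (simp add: n_def card_gt_0_iff)
  have a: "0 \<le> a" using assms n by (auto simp: a_def intro!: sum_nonneg divide_nonneg_nonneg)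
  have X: "(\<Sum>v\<in>V. x v) = n * a" using n by (simp add: a_def)
  have "n * a ^ s = (\<Sum>v\<in>V. a ^ s + real s * a ^ (s - 1) * (x v - a))"
    by (simp add: sum.distrib sum_distrib_left[symmetric] sum_subtractf X flip: n_def)
  also have "\<dots> \<le> (\<Sum>v\<in>V. x v ^ s)"
    using assms a by (intro sum_mono power_tangent_le) auto
  finally have "n ^ (s - 1) * (n * a ^ s) \<le> n ^ (s - 1) * (\<Sum>v\<in>V. x v ^ s)"
    using n by (intro mult_left_mono) auto
  moreover have "n ^ (s - 1) * (n * a ^ s) = (n * a) ^ s"
    using \<open>0 < s\<close> by (cases s) (auto simp: power_mult_distrib)
  ultimately show ?thesis by (simp add: X n_def)
qed

section \<open>Multilinear sums over subsets\<close>

lemma sum_Pow_insert: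
  assumes "finite A" "a \<notin> A"
  shows "(\<Sum>S\<in>Pow (insert a A). g S) = (\<Sum>S\<in>Pow A. g S) + (\<Sum>S\<in>Pow A. g (insert a S))"
proof -
  have "inj_on (insert a) (Pow A)"
    using assms(2) by (auto simp: inj_on_def)
  moreover have "Pow A \<inter> insert a ` Pow A = {}"
    using assms(2) by auto
  ultimately show ?thesis
    using assms(1) by (simp add: Pow_insert sum.union_disjoint sum.reindex)
qed

text \<open>The sum is a multilinear polynomial in the weights, and its value at the indicator
  vector of \<open>U\<close> is the sum of \<open>c\<close> over \<open>Pow U\<close>. Such a
  polynomial is smallest at a vertex of the cube. Equivalently, its value is the mean over random
  sets \<open>U\<close> that contain each \<open>a\<close> independently with probability
  \<open>w a\<close>.\<close>

lemma multilinear_nonneg_on_cube: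
  fixes c :: "'a set \<Rightarrow> real"
  assumes "finite A"
    and "\<And>a. a \<in> A \<Longrightarrow> 0 \<le> w a \<and> w a \<le> 1"
    and "\<And>U. U \<subseteq> A \<Longrightarrow> 0 \<le> (\<Sum>S\<in>Pow U. c S)"
  shows "0 \<le> (\<Sum>S\<in>Pow A. c S * prod w S)"
  using assms
proof (induction A arbitrary: c rule: finite_induct)
  case empty
  from empty.prems(2)[of "{}"] show ?case by simp
next
  case (insert a A)
  \<comment> \<open>These are the coefficients left after fixing the variable of \<open>a\<close> at
    \<open>w a\<close>. Their sum over \<open>Pow U\<close> is a convex combination of the vertex
    values at \<open>U\<close> and \<open>insert a U\<close>.\<close>
  define c' where "c' S = c S + w a * c (insert a S)" for S
  have "0 \<le> (\<Sum>S\<in>Pow A. c' S * prod w S)"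
  proof (rule insert.IH)
    fix U assume U: "U \<subseteq> A"
    with insert have fin: "finite U" and aU: "a \<notin> U"
      by (auto intro: finite_subset)
    have "(\<Sum>S\<in>Pow U. c' S) = (1 - w a) * (\<Sum>S\<in>Pow U. c S) + w a * (\<Sum>S\<in>Pow (insert a U). c S)"
      by (simp add: c'_def sum_Pow_insert[OF fin aU] sum.distrib sum_distrib_left[symmetric]
          algebra_simps)
    moreover have "0 \<le> (\<Sum>S\<in>Pow U. c S)" "0 \<le> (\<Sum>S\<in>Pow (insert a U). c S)"
      using U by (auto intro!: insert.prems(2))
    ultimately show "0 \<le> (\<Sum>S\<in>Pow U. c' S)"
      using insert.prems(1)[of a] by simp
  qed (use insert.prems(1) in auto)
  also have "(\<Sum>S\<in>Pow A. c' S * prod w S)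
      = (\<Sum>S\<in>Pow A. c S * prod w S + c (insert a S) * prod w (insert a S))"
  proof (rule sum.cong)
    fix S assume "S \<in> Pow A"
    with insert have "finite S" "a \<notin> S"
      by (auto intro: finite_subset)
    then show "c' S * prod w S = c S * prod w S + c (insert a S) * prod w (insert a S)"
      by (simp add: c'_def algebra_simps)
  qed simp
  also have "\<dots> = (\<Sum>S\<in>Pow (insert a A). c S * prod w S)"
    using insert by (simp add: sum_Pow_insert sum.distrib)
  finally show ?case .
qed

text \<open>The left-hand side is the elementary symmetric polynomial of degree \<open>s\<close>,
  whose terms all occur in the expansion of the power. The induction splits the sets by whether they
  contain the new element.\<close>

lemma sum_prod_card_le_power:
  fixes x :: "'a \<Rightarrow> real"
  assumes "finite V" "\<And>v. v \<in> V \<Longrightarrow> 0 \<le> x v"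
  shows "(\<Sum>S | S \<subseteq> V \<and> card S = s. prod x S) \<le> (\<Sum>v\<in>V. x v) ^ s"
  using assms
proof (induction V arbitrary: s rule: finite_induct)
  case empty
  have *: "{S. S = {} \<and> card S = s} = (if s = 0 then {{}} else {})" by auto
  show ?case by (simp add: *)
next
  case (insert a A)
  define X where "X = (\<Sum>v\<in>A. x v)"
  have X: "0 \<le> X" "0 \<le> x a" using insert.prems by (auto simp: X_def intro!: sum_nonneg)
  have IH: "(\<Sum>S | S \<subseteq> A \<and> card S = k. prod x S) \<le> X ^ k" for k
    unfolding X_def using insert.prems by (intro insert.IH) auto
  show ?case
  proof (cases s)
    case 0
    then have "{S. S \<subseteq> insert a A \<and> card S = s} = {{}}"
      using insert.hyps by (auto simp: card_eq_0_iff dest: finite_subset)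
    then show ?thesis using 0 by simp
  next
    case (Suc k)
    let ?E = "\<lambda>k. {S. S \<subseteq> A \<and> card S = k}"
    have fin: "finite (?E k)" for k
      by (rule finite_subset[of _ "Pow A"]) (use insert.hyps in auto)
    have not_in: "a \<notin> S" "finite S" if "S \<subseteq> A" for S
      using that insert.hyps by (auto dest: finite_subset)
    have "{S. S \<subseteq> insert a A \<and> card S = s} = ?E s \<union> insert a ` ?E k" (is "?L = ?R")
    proof
      show "?R \<subseteq> ?L"
      proof
        fix S assume "S \<in> ?R"
        then consider "S \<in> ?E s" | T where "T \<in> ?E k" "S = insert a T" by blast
        then show "S \<in> ?L"
        proof cases
          case 2
          with not_in[of T] Suc show ?thesis by auto
        qed auto
      qed
      show "?L \<subseteq> ?R"
      proof
        fix S assume S: "S \<in> ?L"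
        show "S \<in> ?R"
        proof (cases "a \<in> S")
          case True
          then have "S = insert a (S - {a})" by auto
          moreover have "S - {a} \<in> ?E k" using S True Suc by auto
          ultimately show ?thesis by blast
        qed (use S in auto)
      qed
    qed
    moreover have "inj_on (insert a) (?E k)"
      using not_in(1) by (auto simp: inj_on_def insert_ident)
    moreover have "?E s \<inter> insert a ` ?E k = {}"
      using not_in(1) by blast
    ultimately have "(\<Sum>S | S \<subseteq> insert a A \<and> card S = s. prod x S)
        = (\<Sum>S\<in>?E s. prod x S) + (\<Sum>S\<in>?E k. prod x (insert a S))"
      using fin by (simp add: sum.union_disjoint sum.reindex)
    also have "(\<Sum>S\<in>?E k. prod x (insert a S)) = x a * (\<Sum>S\<in>?E k. prod x S)"
      unfolding sum_distrib_left
      by (intro sum.cong[OF refl] prod.insert) (use not_in in auto)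
    also have "(\<Sum>S\<in>?E s. prod x S) + x a * (\<Sum>S\<in>?E k. prod x S) \<le> X * X ^ k + x a * X ^ k"
      using IH[of s] IH[of k] X Suc by (auto intro!: add_mono mult_left_mono)
    also have "\<dots> = (X + x a) * X ^ k" by (simp add: algebra_simps)
    also have "\<dots> \<le> (X + x a) * (X + x a) ^ k"
      using X by (intro mult_left_mono power_mono) auto
    finally show ?thesis
      using insert.hyps Suc by (simp add: X_def add.commute)
  qed
qed

section \<open>Members of a set family inside a given set\<close>

text \<open>Supersaturation by averaging: a member inside \<open>U\<close> survives the deletion of
  exactly \<open>card U - s\<close> points of \<open>U\<close>, so the bounds for all
  \<open>U - {u}\<close> add up to one for \<open>U\<close>. The induction starts at
  \<open>card U = m\<close>, where one member suffices.\<close>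

lemma card_subfamily_ge:
  fixes F :: "'a set set"
  assumes "finite U" and F: "\<And>S. S \<in> F \<Longrightarrow> card S = s" and "0 < m"
    and "\<And>M. M \<subseteq> U \<Longrightarrow> card M = m \<Longrightarrow> \<exists>S\<in>F. S \<subseteq> M"
    and "m \<le> card U"
  shows "(real (card U) / real m) ^ s \<le> real (card {S \<in> F. S \<subseteq> U})"
  using assms(5,1,4)
proof (induction "card U" arbitrary: U)
  case 0
  then show ?case using \<open>0 < m\<close> by simp
next
  case (Suc k)
  have cardU: "card U = Suc k" using Suc.hyps(2) by simp
  show ?case
  proof (cases "card U = m")
    case True
    then obtain S where "S \<in> F" "S \<subseteq> U" using Suc.prems(3)[of U] by auto
    moreover have "finite {S \<in> F. S \<subseteq> U}"
      by (rule finite_subset[of _ "Pow U"]) (use Suc.prems in auto)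
    ultimately have "1 \<le> card {S \<in> F. S \<subseteq> U}"
      by (auto simp: Suc_le_eq card_gt_0_iff)
    moreover have "real (card U) / real m = 1"
      using True \<open>0 < m\<close> by simp
    ultimately show ?thesis by simp
  next
    case False
    then have mk: "m \<le> k" using Suc.prems(1) cardU by simp
    let ?F = "\<lambda>U. {S \<in> F. S \<subseteq> U}"
    have fin: "finite (?F U)"
      by (rule finite_subset[of _ "Pow U"]) (use Suc.prems in auto)
    have kpos: "0 < real k" using \<open>0 < m\<close> mk by simp
    have IH: "(real k / real m) ^ s \<le> real (card (?F (U - {u})))" if "u \<in> U" for u
    proof -
      have k: "k = card (U - {u})" using cardU that by simp
      show ?thesis
        using Suc.hyps(1)[OF k] Suc.prems k mk by auto
    qed
    have "real (Suc k) * (real k / real m) ^ s \<le> (\<Sum>u\<in>U. real (card (?F (U - {u}))))"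
      using sum_mono[of U "\<lambda>_. (real k / real m) ^ s" "\<lambda>u. real (card (?F (U - {u})))"] IH cardU
      by simp
    also have "\<dots> = (\<Sum>u\<in>U. \<Sum>S\<in>?F U. if u \<notin> S then 1 else 0)"
    proof (rule sum.cong)
      fix u assume "u \<in> U"
      have "?F (U - {u}) = {S \<in> ?F U. u \<notin> S}" by auto
      then have "real (card (?F (U - {u}))) = (\<Sum>S | S \<in> ?F U \<and> u \<notin> S. 1)"
        by (simp only: real_of_card)
      also have "\<dots> = (\<Sum>S\<in>?F U. if u \<notin> S then 1 else 0)"
        by (rule sum.inter_filter[OF fin])
      finally show "real (card (?F (U - {u}))) = (\<Sum>S\<in>?F U. if u \<notin> S then 1 else 0)" .
    qed simp
    also have "\<dots> = (\<Sum>S\<in>?F U. \<Sum>u\<in>U. if u \<notin> S then 1 else 0)"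
      by (rule sum.swap)
    also have "\<dots> = (\<Sum>S\<in>?F U. real (Suc k) - real s)"
    proof (rule sum.cong)
      fix S assume S: "S \<in> ?F U"
      have "(\<Sum>u\<in>U. if u \<notin> S then 1 else 0) = real (card (U - S))"
        using Suc.prems(2) by (simp flip: sum.inter_filter set_diff_eq)
      moreover have "card S \<le> card U" "card (U - S) = card U - card S"
        using S Suc.prems by (auto intro!: card_mono card_Diff_subset intro: finite_subset)
      ultimately show "(\<Sum>u\<in>U. if u \<notin> S then 1 else 0) = real (Suc k) - real s"
        using S F[of S] cardU by simp
    qed simp
    also have "\<dots> = real (card (?F U)) * (real (Suc k) - real s)" by simp
    finally have *: "real (Suc k) * (real k / real m) ^ s
      \<le> real (card (?F U)) * (real (Suc k) - real s)" .
    \<comment> \<open>The left-hand side of \<open>*\<close> is positive, which forces the factor on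
      the right to be positive, so that it can be cancelled below.\<close>
    have "real (Suc k) - real s > 0"
    proof (rule ccontr)
      assume "\<not> ?thesis"
      then have "real (card (?F U)) * (real (Suc k) - real s) \<le> 0"
        by (simp add: mult_nonneg_nonpos)
      moreover have "real (Suc k) * (real k / real m) ^ s > 0"
        using kpos \<open>0 < m\<close> by simp
      ultimately show False using * by linarith
    qed
    \<comment> \<open>Bernoulli's inequality at \<open>- 1 / real (Suc k)\<close> shows that the
      averaging step loses nothing against the claimed bound.\<close>
    moreover have "(real (Suc k) / real m) ^ s * (real (Suc k) - real s)
        \<le> real (Suc k) * (real k / real m) ^ s"
    proof -
      let ?k = "real (Suc k)"
      have "1 + real s * (- 1 / ?k) \<le> (1 + (- 1 / ?k)) ^ s"
        by (rule Bernoulli_inequality) auto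
      then have "(?k / real m) ^ s * (?k * (1 + real s * (- 1 / ?k)))
          \<le> (?k / real m) ^ s * (?k * (1 + (- 1 / ?k)) ^ s)"
        by (intro mult_left_mono) auto
      also have "\<dots> = ?k * ((?k / real m) * (1 + (- 1 / ?k))) ^ s"
        unfolding power_mult_distrib by (simp only: mult_ac)
      finally have "(?k / real m) ^ s * (?k * (1 + real s * (- 1 / ?k)))
          \<le> ?k * ((?k / real m) * (1 + (- 1 / ?k))) ^ s" .
      moreover have "?k * (1 + (- 1 / ?k)) = real k"
        by (simp add: field_simps)
      then have "(?k / real m) * (1 + (- 1 / ?k)) = real k / real m"
        by (simp only: times_divide_eq_left)
      moreover have "?k * (1 + real s * (- 1 / ?k)) = ?k - real s"
        by (simp add: field_simps)
      ultimately show ?thesis by (simp only:)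
    qed
    ultimately have "(real (Suc k) / real m) ^ s \<le> real (card (?F U))"
      using * by (meson order_trans mult_le_cancel_right_pos)
    then show ?thesis using cardU by simp
  qed
qed

text \<open>For a random \<open>U\<close> containing each \<open>a\<close> independently with
  probability \<open>w a\<close>, the right-hand side is the expected number of members inside
  \<open>U\<close>. The \<open>- 1\<close> pays for sets with fewer than \<open>m\<close> elements,
  which may contain no member but have \<open>(card U / m) ^ s \<le> 1\<close>.\<close>

lemma weighted_subfamily_ge:
  fixes F :: "'a set set" and w :: "'a \<Rightarrow> real"
  assumes "finite A" and F: "\<And>S. S \<in> F \<Longrightarrow> card S = s" and "0 < m" "0 < s"
    and M: "\<And>M. M \<subseteq> A \<Longrightarrow> card M = m \<Longrightarrow> \<exists>S\<in>F. S \<subseteq> M"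
    and w: "\<And>a. a \<in> A \<Longrightarrow> 0 \<le> w a \<and> w a \<le> 1"
  shows "((\<Sum>a\<in>A. w a) / real m) ^ s - 1 \<le> (\<Sum>S | S \<in> F \<and> S \<subseteq> A. prod w S)"
proof -
  define W where "W = (\<Sum>a\<in>A. w a) / real m"
  \<comment> \<open>The tangent to \<open>y ^ s - 1\<close> at \<open>W\<close>, with
    \<open>y = card U / m\<close>, is \<open>d * card U + e\<close>.\<close>
  define d where "d = real s * W ^ (s - 1) / real m"
  define e where "e = W ^ s - real s * W ^ (s - 1) * W - 1"
  have W: "0 \<le> W" unfolding W_def using w by (auto intro!: divide_nonneg_nonneg sum_nonneg)
  \<comment> \<open>Coefficients of the number of members minus the tangent: each singleton
    contributes \<open>- d\<close>, and the empty set \<open>- e\<close>.\<close>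
  define c :: "'a set \<Rightarrow> real" where
    "c S = (if S \<in> F then 1 else 0) - (if \<exists>a. S = {a} then d else 0) - (if S = {} then e else 0)" for S
  have expand: "(\<Sum>S\<in>Pow U. c S * g S)
      = (\<Sum>S | S \<in> F \<and> S \<subseteq> U. g S) - d * (\<Sum>a\<in>U. g {a}) - e * g {}"
    if "finite U" for U and g :: "'a set \<Rightarrow> real"
  proof -
    have "(\<Sum>S\<in>Pow U. c S * g S) = (\<Sum>S\<in>Pow U. if S \<in> F then g S else 0)
        - (\<Sum>S\<in>Pow U. if \<exists>a. S = {a} then d * g S else 0) - (\<Sum>S\<in>Pow U. if S = {} then e * g S else 0)"
      unfolding sum_subtractf[symmetric] by (intro sum.cong) (auto simp: c_def algebra_simps)
    also have "(\<Sum>S\<in>Pow U. if S \<in> F then g S else 0) = (\<Sum>S | S \<in> F \<and> S \<subseteq> U. g S)"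
      using that by (simp add: sum.inter_filter[symmetric] conj_commute)
    also have "(\<Sum>S\<in>Pow U. if \<exists>a. S = {a} then d * g S else 0) = (\<Sum>S\<in>(\<lambda>a. {a}) ` U. d * g S)"
      using that by (simp add: sum.If_cases, intro sum.cong) auto
    also have "\<dots> = d * (\<Sum>a\<in>U. g {a})"
      by (simp add: sum.reindex sum_distrib_left)
    also have "(\<Sum>S\<in>Pow U. if S = {} then e * g S else 0) = e * g {}"
      using that by (simp add: sum.delta)
    finally show ?thesis .
  qed
  \<comment> \<open>Jensen: by multilinearity, an affine minorant in \<open>|U|\<close> (here the tangent at \<open>W\<close>)
     of the number of members inside \<open>U\<close> only has to be checked for sets \<open>U\<close>.\<close>
  have "0 \<le> (\<Sum>S\<in>Pow A. c S * prod w S)"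
  proof (rule multilinear_nonneg_on_cube)
    fix U assume U: "U \<subseteq> A"
    then have fin: "finite U" using \<open>finite A\<close> by (rule finite_subset)
    define y where "y = real (card U) / real m"
    have "y ^ s - 1 \<le> real (card {S \<in> F. S \<subseteq> U})"
    proof (cases "m \<le> card U")
      case True
      have "y ^ s \<le> real (card {S \<in> F. S \<subseteq> U})"
        unfolding y_def using fin F \<open>0 < m\<close>
        by (rule card_subfamily_ge) (use M U True in auto)
      then show ?thesis by simp
    next
      case False
      then have "y ^ s \<le> 1" unfolding y_def by (intro power_le_one) auto
      moreover have "0 \<le> real (card {S \<in> F. S \<subseteq> U})" by simp
      ultimately show ?thesis by linarith
    qed
    moreover have "W ^ s + real s * W ^ (s - 1) * (y - W) \<le> y ^ s"
      using W \<open>0 < s\<close> by (intro power_tangent_le) (auto simp: y_def)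
    moreover have "real s * W ^ (s - 1) * y = d * real (card U)"
      by (simp add: d_def y_def)
    moreover have "(\<Sum>S\<in>Pow U. c S) = real (card {S \<in> F. S \<subseteq> U}) - d * real (card U) - e"
      using expand[OF fin, of "\<lambda>_. 1"] by simp
    ultimately show "0 \<le> (\<Sum>S\<in>Pow U. c S)"
      by (simp add: e_def algebra_simps)
  qed (use assms in auto)
  also have "\<dots> = (\<Sum>S | S \<in> F \<and> S \<subseteq> A. prod w S) - d * (\<Sum>a\<in>A. w a) - e"
    using expand[OF \<open>finite A\<close>, of "prod w"] by simp
  \<comment> \<open>The expected size of \<open>U\<close> corresponds to the point of tangency, so
    the tangent takes the value \<open>W ^ s - 1\<close> there.\<close>
  also have "d * (\<Sum>a\<in>A. w a) = real s * W ^ (s - 1) * W"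
    by (simp add: d_def W_def)
  finally show ?thesis
    unfolding W_def[symmetric] e_def by simp
qed

section \<open>Double counting of common neighbours\<close>

text \<open>The graph enters only through its neighbourhoods \<open>N\<close>, the family
  \<open>F\<close> of independent sets and the weights \<open>x\<close>. The core is a double count
  of the pairs \<open>S\<close>, \<open>v\<close> with \<open>S \<subseteq> N v\<close>, weighted by
  \<open>prod x S\<close>.\<close>

lemma exists_common_neighbours:
  fixes V :: "'a set" and N :: "'a \<Rightarrow> 'a set" and x :: "'a \<Rightarrow> real" and l :: real
  assumes fin: "finite V" and N: "\<And>v. v \<in> V \<Longrightarrow> N v \<subseteq> V"
    and F: "\<And>S. S \<in> F \<Longrightarrow> S \<subseteq> V \<and> card S = s"
    and M: "\<And>M. M \<subseteq> V \<Longrightarrow> card M = m \<Longrightarrow> \<exists>S\<in>F. S \<subseteq> M"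
    and x: "\<And>v. v \<in> V \<Longrightarrow> 0 \<le> x v \<and> x v \<le> 1"
    and top: "p \<in> V" "x p = 1"
    and l: "\<And>v. v \<in> V \<Longrightarrow> l * x v \<le> (\<Sum>u\<in>N v. x u)"
    and "0 < m" "2 \<le> s" "2 \<le> r" "0 \<le> l"
    and big: "real m ^ s * real r ^ 2 * real (card V) ^ (s - 1) \<le> l ^ s"
  shows "\<exists>S\<in>F. r \<le> card {v \<in> V. S \<subseteq> N v}"
proof (rule ccontr)
  assume "\<not> ?thesis"
  then have small: "card {v \<in> V. S \<subseteq> N v} \<le> r - 1" if "S \<in> F" for S
    using that by force
  have "0 < s" using \<open>2 \<le> s\<close> by simp
  define n where "n = real (card V)"
  define X where "X = (\<Sum>v\<in>V. x v)"
  have n: "n \<ge> 1"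
    using fin top by (auto simp: n_def Suc_le_eq card_gt_0_iff)
  have finF: "finite F"
    by (rule finite_subset[of _ "Pow V"]) (use F fin in auto)
  have m: "real m ^ s > 0" using \<open>0 < m\<close> by simp
  have prod_nonneg': "0 \<le> prod x S" if "S \<in> F" for S
    using F[OF that] x by (auto intro!: prod_nonneg)
  \<comment> \<open>The vertex of weight 1 ties the total weight to the eigenvalue.\<close>
  have "l \<le> (\<Sum>u\<in>N p. x u)" using l[OF top(1)] top by simp
  also have "\<dots> \<le> X"
    unfolding X_def using fin N top x by (intro sum_mono2) auto
  finally have lX: "l \<le> X" .
  have local: "(l * x v) ^ s \<le> real m ^ s * ((\<Sum>S | S \<in> F \<and> S \<subseteq> N v. prod x S) + 1)"
    if v: "v \<in> V" for v
  proof -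
    have "((\<Sum>u\<in>N v. x u) / real m) ^ s - 1 \<le> (\<Sum>S | S \<in> F \<and> S \<subseteq> N v. prod x S)"
    proof (rule weighted_subfamily_ge)
      show "finite (N v)" using N[OF v] fin by (rule finite_subset)
      show "\<And>S. S \<in> F \<Longrightarrow> card S = s" using F by auto
      show "\<And>M. M \<subseteq> N v \<Longrightarrow> card M = m \<Longrightarrow> \<exists>S\<in>F. S \<subseteq> M"
        using M N[OF v] by blast
      show "\<And>a. a \<in> N v \<Longrightarrow> 0 \<le> x a \<and> x a \<le> 1" using x N[OF v] by auto
    qed fact+
    then have "(\<Sum>u\<in>N v. x u) ^ s \<le> real m ^ s * ((\<Sum>S | S \<in> F \<and> S \<subseteq> N v. prod x S) + 1)"
      using m by (simp add: power_divide field_simps)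
    moreover have "(l * x v) ^ s \<le> (\<Sum>u\<in>N v. x u) ^ s"
      using l[OF v] x[OF v] \<open>0 \<le> l\<close> by (intro power_mono) auto
    ultimately show ?thesis by linarith
  qed
  have "(\<Sum>v\<in>V. \<Sum>S | S \<in> F \<and> S \<subseteq> N v. prod x S)
      = (\<Sum>v\<in>V. \<Sum>S\<in>F. if S \<subseteq> N v then prod x S else 0)"
    using finF by (intro sum.cong[OF refl] sum.inter_filter)
  also have "\<dots> = (\<Sum>S\<in>F. \<Sum>v\<in>V. if S \<subseteq> N v then prod x S else 0)"
    by (rule sum.swap)
  also have "\<dots> = (\<Sum>S\<in>F. real (card {v \<in> V. S \<subseteq> N v}) * prod x S)"
    using fin by (intro sum.cong[OF refl]) (simp flip: sum.inter_filter)
  also have "\<dots> \<le> (\<Sum>S\<in>F. (real r - 1) * prod x S)"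
  proof (intro sum_mono mult_right_mono prod_nonneg')
    fix S assume "S \<in> F"
    then show "real (card {v \<in> V. S \<subseteq> N v}) \<le> real r - 1"
      using small[of S] \<open>2 \<le> r\<close> by linarith
  qed
  also have "\<dots> = (real r - 1) * (\<Sum>S\<in>F. prod x S)"
    by (simp add: sum_distrib_left)
  \<comment> \<open>Enlarging \<open>F\<close> to all \<open>s\<close>-subsets turns the sum into an
    elementary symmetric polynomial.\<close>
  also have "\<dots> \<le> (real r - 1) * (\<Sum>S | S \<subseteq> V \<and> card S = s. prod x S)"
  proof (intro mult_left_mono sum_mono2)
    show "finite {S. S \<subseteq> V \<and> card S = s}"
      by (rule finite_subset[of _ "Pow V"]) (use fin in auto)
  qed (use F x \<open>2 \<le> r\<close> in \<open>auto intro!: prod_nonneg\<close>)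
  also have "\<dots> \<le> (real r - 1) * X ^ s"
    unfolding X_def using fin x \<open>2 \<le> r\<close> by (intro mult_left_mono sum_prod_card_le_power) auto
  finally have count: "(\<Sum>v\<in>V. \<Sum>S | S \<in> F \<and> S \<subseteq> N v. prod x S) \<le> (real r - 1) * X ^ s" .
  have "real m ^ s * (n ^ (s - 1) * (real r ^ 2 * X ^ s)) \<le> l ^ s * X ^ s"
    using mult_right_mono[OF big, of "X ^ s"] lX \<open>0 \<le> l\<close> by (simp add: n_def mult_ac)
  also have "l ^ s * X ^ s = (\<Sum>v\<in>V. l * x v) ^ s"
    by (simp add: X_def sum_distrib_left[symmetric] power_mult_distrib)
  also have "\<dots> \<le> n ^ (s - 1) * (\<Sum>v\<in>V. (l * x v) ^ s)"
    unfolding n_def using fin x \<open>0 \<le> l\<close> \<open>0 < s\<close> by (intro power_sum_le_card_power_sum) auto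
  also have "(\<Sum>v\<in>V. (l * x v) ^ s)
      \<le> (\<Sum>v\<in>V. real m ^ s * ((\<Sum>S | S \<in> F \<and> S \<subseteq> N v. prod x S) + 1))"
    by (intro sum_mono local)
  also have "\<dots> = real m ^ s * ((\<Sum>v\<in>V. \<Sum>S | S \<in> F \<and> S \<subseteq> N v. prod x S) + n)"
    by (simp add: sum_distrib_left[symmetric] sum.distrib n_def)
  also have "\<dots> \<le> real m ^ s * ((real r - 1) * X ^ s + n)"
    using count by (intro mult_left_mono) auto
  finally have "(real m ^ s * n ^ (s - 1)) * (real r ^ 2 * X ^ s)
      \<le> (real m ^ s * n ^ (s - 1)) * ((real r - 1) * X ^ s + n)"
    using n by (simp add: mult_ac)
  then have 1: "real r ^ 2 * X ^ s \<le> (real r - 1) * X ^ s + n"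
    using m n by (subst (asm) mult_le_cancel_left_pos) auto
  \<comment> \<open>The additive error \<open>n\<close> in \<open>1\<close> is absorbed by
    \<open>4 * n \<le> X ^ s\<close>, which comes from \<open>big\<close> and
    \<open>l \<le> X\<close>. Since \<open>r^2 - (r - 1)\<close> is at least 1, \<open>1\<close>
    yields \<open>X ^ s \<le> n\<close>, a contradiction.\<close>
  have "1 \<le> real m ^ s" using \<open>0 < m\<close> by (intro one_le_power) auto
  moreover have "4 \<le> real r ^ 2" using power_mono[of 2 "real r" 2] \<open>2 \<le> r\<close> by simp
  moreover have "n \<le> n ^ (s - 1)" using power_increasing[of 1 "s - 1" n] n \<open>2 \<le> s\<close> by simp
  ultimately have "1 * 4 * n \<le> real m ^ s * real r ^ 2 * n ^ (s - 1)"
    using n by (intro mult_mono) auto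
  also have "\<dots> \<le> l ^ s" using big by (simp add: n_def)
  also have "\<dots> \<le> X ^ s" using lX \<open>0 \<le> l\<close> by (intro power_mono)
  finally have 2: "4 * n \<le> X ^ s" by simp
  have "1 \<le> real r ^ 2 - (real r - 1)"
    using mult_left_mono[of 1 "real r" "real r"] \<open>2 \<le> r\<close> by (simp add: power2_eq_square)
  then have "1 * X ^ s \<le> (real r ^ 2 - (real r - 1)) * X ^ s"
    using 2 n by (intro mult_right_mono) auto
  with 1 have "X ^ s \<le> n" by (simp add: algebra_simps)
  with 2 n show False by simp
qed

section \<open>Copies of graphs and Ramsey numbers\<close>

text \<open>Replaces library isomorphisms, which also act on arcs, by injective homomorphisms on
  vertices. In the converse direction the arc map is forced to be
  \<open>map_prod f f\<close>.\<close>

lemma contains_copy_iff: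
  assumes "pair_wf_digraph H" "pair_wf_digraph G"
  shows "contains_copy H G \<longleftrightarrow>
    (\<exists>f. inj_on f (pverts H) \<and> f ` pverts H \<subseteq> pverts G \<and>
         (\<forall>u v. (u, v) \<in> parcs H \<longrightarrow> (f u, f v) \<in> parcs G))"
    (is "_ \<longleftrightarrow> (\<exists>f. ?hom f)")
proof
  assume "contains_copy H G"
  then obtain h where h: "subgraph (app_iso h (with_proj H)) (with_proj G)"
      "pre_digraph.digraph_isomorphism (with_proj H) h"
    by (auto simp: contains_copy_def digraph_iso_def)
  then have "?hom (iso_verts h)"
    by (fastforce simp: subgraph_def compatible_def pre_digraph.digraph_isomorphism_def)
  then show "\<exists>f. ?hom f" by blast
next
  interpret H: pair_wf_digraph H by fact
  interpret G: pair_wf_digraph G by fact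
  assume "\<exists>f. ?hom f"
  then obtain f where f: "?hom f" ..
  define h where "h = \<lparr>iso_verts = f, iso_arcs = map_prod f f, iso_head = snd, iso_tail = fst\<rparr>"
  have "inj_on (map_prod f f) (parcs H)"
  proof (rule inj_on_subset)
    show "inj_on (map_prod f f) (pverts H \<times> pverts H)"
      using f by (intro map_prod_inj_on) auto
    show "parcs H \<subseteq> pverts H \<times> pverts H"
      by (auto dest: H.wellformed')
  qed
  then have iso: "pre_digraph.digraph_isomorphism (with_proj H) h"
    using f H.wf_digraph_axioms by (auto simp: pre_digraph.digraph_isomorphism_def h_def)
  have "wf_digraph (app_iso h (with_proj H))"
    by (rule H.wf_digraphI_app_iso[OF iso])
  then have "subgraph (app_iso h (with_proj H)) (with_proj G)"
    using f G.wf_digraph_axioms by (auto simp: subgraph_def compatible_def h_def)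
  with iso show "contains_copy H G"
    by (auto simp: contains_copy_def digraph_iso_def)
qed

lemma pair_graphI:
  assumes "finite (pverts G)" "parcs G \<subseteq> pverts G \<times> pverts G" "sym (parcs G)" "irrefl (parcs G)"
  shows "pair_graph G"
  using assms
  by unfold_locales (auto simp: symmetric_def irrefl_def intro: finite_subset)

lemma pair_graphD:
  assumes "pair_graph G"
  shows "finite (pverts G)" "parcs G \<subseteq> pverts G \<times> pverts G" "sym (parcs G)" "irrefl (parcs G)"
proof -
  interpret pair_graph G by fact
  show "finite (pverts G)" by (rule pair_finite_verts)
  show "parcs G \<subseteq> pverts G \<times> pverts G" by (auto dest: wellformed')
  show "sym (parcs G)" using pair_sym_arcs by (simp add: symmetric_def)
  show "irrefl (parcs G)" using pair_no_loops[of "(a, a)" for a] by (auto simp: irrefl_def)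
qed

lemma pair_graph_imp_pair_wf_digraph: "pair_graph G \<Longrightarrow> pair_wf_digraph G"
  by (simp add: pair_graph_def pair_digraph_def pair_fin_digraph_def)

lemma pair_graph_complement: "pair_graph G \<Longrightarrow> pair_graph (graph_complement G)"
  by (frule pair_graphD(1), frule pair_graphD(3))
    (auto simp: graph_complement_def irrefl_def sym_def intro!: pair_graphI)

lemma pair_graph_complete_graph: "pair_graph (complete_graph n)"
  by (auto simp: complete_graph_def irrefl_def sym_def intro!: pair_graphI)

lemma contains_copy_complete_graph_complement_iff:
  assumes "pair_graph G"
  shows "contains_copy (complete_graph t) (graph_complement G) \<longleftrightarrow>
    (\<exists>T. T \<subseteq> pverts G \<and> card T = t \<and> (\<forall>u\<in>T. \<forall>v\<in>T. (u, v) \<notin> parcs G))"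
    (is "?L \<longleftrightarrow> (\<exists>T. ?P T)")
proof -
  have "?L \<longleftrightarrow> (\<exists>f. inj_on f {..<t} \<and> f ` {..<t} \<subseteq> pverts G \<and>
      (\<forall>i<t. \<forall>j<t. i \<noteq> j \<longrightarrow> f i \<noteq> f j \<and> (f i, f j) \<notin> parcs G))"
    unfolding contains_copy_iff[OF pair_graph_complete_graph[THEN pair_graph_imp_pair_wf_digraph]
        pair_graph_complement[OF assms, THEN pair_graph_imp_pair_wf_digraph]]
    by (intro arg_cong[where f = Ex] ext)
      (auto simp: graph_complement_def complete_graph_def image_subset_iff)
  also have "\<dots> \<longleftrightarrow> (\<exists>T. ?P T)"
  proof safe
    fix f assume f: "inj_on f {..<t}" "f ` {..<t} \<subseteq> pverts G"
      "\<forall>i<t. \<forall>j<t. i \<noteq> j \<longrightarrow> f i \<noteq> f j \<and> (f i, f j) \<notin> parcs G"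
    have "?P (f ` {..<t})"
      using f pair_graphD(4)[OF assms] by (auto simp: card_image irrefl_def)
    then show "\<exists>T. ?P T" ..
  next
    fix T assume T: "T \<subseteq> pverts G" "\<forall>u\<in>T. \<forall>v\<in>T. (u, v) \<notin> parcs G" "t = card T"
    have "finite T" using T(1) pair_graphD(1)[OF assms] by (rule finite_subset)
    then obtain f where f: "bij_betw f {..<card T} T"
      using ex_bij_betw_nat_finite by (metis atLeast0LessThan)
    then have "\<forall>i<card T. f i \<in> T" "\<forall>i<card T. \<forall>j<card T. i \<noteq> j \<longrightarrow> f i \<noteq> f j"
      by (auto simp: bij_betw_def inj_on_def)
    with f T show "\<exists>f. inj_on f {..<card T} \<and> f ` {..<card T} \<subseteq> pverts G \<and>
      (\<forall>i<card T. \<forall>j<card T. i \<noteq> j \<longrightarrow> f i \<noteq> f j \<and> (f i, f j) \<notin> parcs G)"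
      by (intro exI[of _ f]) (auto simp: bij_betw_def)
  qed
  finally show ?thesis .
qed

section \<open>Ramsey's theorem and independent sets\<close>

text \<open>The \<open>LEAST\<close> in the definition is meaningful only if some \<open>N\<close>
  works. Ramsey's theorem supplies one, as a clique on \<open>card (pverts H)\<close> vertices
  contains a copy of \<open>H\<close>.\<close>

lemma ramsey_number_property:
  fixes G :: "nat pair_pre_digraph"
  assumes H: "pair_graph H" and "pair_graph G"
    and "card (pverts G) = ramsey_number H (complete_graph t)"
  shows "contains_copy H G \<or> contains_copy (complete_graph t) (graph_complement G)"
proof -
  let ?R = "\<lambda>N. \<forall>G :: nat pair_pre_digraph. pair_graph G \<and> card (pverts G) = N \<longrightarrow>
       contains_copy H G \<or> contains_copy (complete_graph t) (graph_complement G)"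
  obtain N where N: "\<And>(V :: nat set) E. finite V \<Longrightarrow> N \<le> card V \<Longrightarrow>
      \<exists>R\<subseteq>V. card R = card (pverts H) \<and> clique R E \<or> card R = t \<and> indep R E"
    using ramsey2[of "card (pverts H)" t] by metis
  have "?R N"
  proof (intro allI impI)
    fix G :: "nat pair_pre_digraph"
    assume G: "pair_graph G \<and> card (pverts G) = N"
    note G' = pair_graphD[OF conjunct1[OF G]]
    \<comment> \<open>\<open>ramsey2\<close> speaks of unordered pairs, so each pair of opposite
      arcs becomes a doubleton.\<close>
    define E where "E = {{u, v} | u v. (u, v) \<in> parcs G}"
    have E: "{u, v} \<in> E \<longleftrightarrow> (u, v) \<in> parcs G" for u v
      using G'(3) by (auto simp: E_def doubleton_eq_iff sym_def)
    obtain R where R: "R \<subseteq> pverts G"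
      "card R = card (pverts H) \<and> clique R E \<or> card R = t \<and> indep R E"
      using N[of "pverts G" E] G G' by auto
    from R(2) show "contains_copy H G \<or> contains_copy (complete_graph t) (graph_complement G)"
    proof (elim disjE conjE)
      assume card: "card R = card (pverts H)" and cl: "clique R E"
      have "finite R" using R(1) G'(1) by (rule finite_subset)
      then obtain f where f: "bij_betw f (pverts H) R"
        using finite_same_card_bij[OF pair_graphD(1)[OF H]] card by metis
      have "(f u, f v) \<in> parcs G" if "(u, v) \<in> parcs H" for u v
      proof -
        from that have "u \<in> pverts H" "v \<in> pverts H" "u \<noteq> v"
          using pair_graphD[OF H] by (auto simp: irrefl_def)
        with f cl show ?thesis
          unfolding clique_def E by (metis bij_betw_apply bij_betw_imp_inj_on inj_onD)
      qed
      then show ?thesis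
        using f R(1) H G
        by (subst contains_copy_iff) (auto simp: bij_betw_def intro: pair_graph_imp_pair_wf_digraph)
    next
      assume "card R = t" "indep R E"
      moreover have "\<forall>v. (v, v) \<notin> parcs G" using G'(4) by (auto simp: irrefl_def)
      ultimately show ?thesis
        using R(1) G contains_copy_complete_graph_complement_iff[of G t]
        unfolding indep_def E by metis
    qed
  qed
  then have "?R (ramsey_number H (complete_graph t))"
    unfolding ramsey_number_def by (rule LeastI)
  with assms show ?thesis by blast
qed

text \<open>Ramsey numbers quantify over graphs on natural numbers. The subgraph induced on
  \<open>U\<close> is therefore pulled back along an enumeration \<open>g\<close> of
  \<open>U\<close>, and the independent set found is pushed forward.\<close>

lemma independent_set_of_ramsey_number:
  assumes H: "pair_graph H" and G: "pair_graph G" and "free_of H G"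
    and U: "U \<subseteq> pverts G" "card U = ramsey_number H (complete_graph t)"
  shows "\<exists>T. T \<subseteq> U \<and> card T = t \<and> (\<forall>u\<in>T. \<forall>v\<in>T. (u, v) \<notin> parcs G)"
proof -
  note G' = pair_graphD[OF G]
  have "finite U" using U(1) G'(1) by (rule finite_subset)
  then obtain g :: "nat \<Rightarrow> 'b" where g: "bij_betw g {..<card U} U"
    using ex_bij_betw_nat_finite by (metis atLeast0LessThan)
  define L where "L = \<lparr>pverts = {..<card U},
    parcs = {(i, j). i < card U \<and> j < card U \<and> (g i, g j) \<in> parcs G}\<rparr>"
  have L: "pair_graph L"
    using G' by (auto simp: L_def sym_def irrefl_def intro!: pair_graphI)
  have "\<not> contains_copy H L"
  proof
    assume "contains_copy H L"
    then obtain f where f: "inj_on f (pverts H)" "f ` pverts H \<subseteq> {..<card U}"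
      "\<forall>u v. (u, v) \<in> parcs H \<longrightarrow> (g (f u), g (f v)) \<in> parcs G"
      by (subst (asm) contains_copy_iff)
        (use H L in \<open>auto simp: L_def intro: pair_graph_imp_pair_wf_digraph\<close>)
    have "inj_on (g \<circ> f) (pverts H)"
      using f g by (intro comp_inj_on) (auto simp: bij_betw_def intro: inj_on_subset)
    moreover have "(g \<circ> f) ` pverts H \<subseteq> pverts G"
      using f(2) bij_betw_imp_surj_on[OF g] U(1) by fastforce
    ultimately have "contains_copy H G"
      using f(3) H G
      by (subst contains_copy_iff) (auto intro!: pair_graph_imp_pair_wf_digraph exI[of _ "g \<circ> f"])
    with \<open>free_of H G\<close> show False by (simp add: free_of_def)
  qed
  moreover have "card (pverts L) = ramsey_number H (complete_graph t)"
    using U by (simp add: L_def)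
  ultimately have "contains_copy (complete_graph t) (graph_complement L)"
    using ramsey_number_property[OF H L] by blast
  then obtain T where T: "T \<subseteq> {..<card U}" "card T = t" "\<forall>i\<in>T. \<forall>j\<in>T. (i, j) \<notin> parcs L"
    unfolding contains_copy_complete_graph_complement_iff[OF L] by (auto simp: L_def)
  have "inj_on g T" using g T(1) by (auto simp: bij_betw_def intro: inj_on_subset)
  then have "card (g ` T) = t" using T by (simp add: card_image)
  moreover have "g ` T \<subseteq> U" using g T(1) by (auto simp: bij_betw_def)
  moreover have "\<forall>u\<in>g ` T. \<forall>v\<in>g ` T. (u, v) \<notin> parcs G"
    using T by (auto simp: L_def subset_iff)
  ultimately show ?thesis by blast
qed

lemma contains_induced_complete_bipartiteI:
  assumes G: "pair_graph G"
    and ST: "S \<subseteq> pverts G" "T \<subseteq> pverts G" "card S = s" "card T = t"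
    and S: "\<forall>u\<in>S. \<forall>v\<in>S. (u, v) \<notin> parcs G"
    and T: "\<forall>u\<in>T. \<forall>v\<in>T. (u, v) \<notin> parcs G"
    and edges: "\<forall>u\<in>S. \<forall>v\<in>T. (u, v) \<in> parcs G"
  shows "contains_induced_complete_bipartite s t G"
proof -
  note G' = pair_graphD[OF G]
  define F where "F = \<lparr>pverts = S \<union> T, parcs = S \<times> T \<union> T \<times> S\<rparr>"
  \<comment> \<open>A common vertex would carry a loop.\<close>
  have "S \<inter> T = {}" using edges G'(4) by (auto simp: irrefl_def)
  moreover have "finite (S \<union> T)" using ST G'(1) by (auto intro: finite_subset)
  ultimately have K: "K\<^bsub>s,t\<^esub> (with_proj F)"
    using ST unfolding complete_bipartite_digraph_pair_def F_def by auto
  have "pair_wf_digraph F" by unfold_locales (auto simp: F_def)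
  then have "wf_digraph (with_proj F)" "wf_digraph (with_proj G)"
    using pair_graph_imp_pair_wf_digraph[OF G] by (auto intro: wf_digraph_wp_iff[THEN iffD2])
  then have "induced_subgraph (with_proj F) (with_proj G)"
    using ST S T edges G'(3)
    by (auto simp: induced_subgraph_def subgraph_def compatible_def F_def sym_def)
  with K show ?thesis unfolding contains_induced_complete_bipartite_def by blast
qed

section \<open>The largest eigenvalue\<close>

lemma eigenvector_component:
  assumes "A \<in> carrier_mat n n" "eigenvector A v k" "i < n"
  shows "(\<Sum>j<n. A $$ (i, j) * v $ j) = k * v $ i"
proof -
  from assms have v: "v \<in> carrier_vec n" "A *\<^sub>v v = k \<cdot>\<^sub>v v"
    by (auto simp: eigenvector_def)
  have "(\<Sum>j<n. A $$ (i, j) * v $ j) = (A *\<^sub>v v) $ i"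
    using v(1) assms(1,3) by (simp add: scalar_prod_def atLeast0LessThan)
  also have "\<dots> = (k \<cdot>\<^sub>v v) $ i" by (simp only: v(2))
  also have "\<dots> = k * v $ i" using v(1) assms(3) by simp
  finally show ?thesis .
qed

text \<open>Ensures that the \<open>Max\<close> in \<open>largest_eigenvalue\<close> ranges over a
  nonempty set. A complex eigenvalue exists, and symmetry makes it real.\<close>

lemma real_symmetric_spectrum_nonempty:
  fixes A :: "real mat"
  assumes A: "A \<in> carrier_mat n n" and "0 < n"
    and sym: "\<And>i j. i < n \<Longrightarrow> j < n \<Longrightarrow> A $$ (i, j) = A $$ (j, i)"
  shows "spectrum A \<noteq> {}"
proof -
  let ?C = "map_mat complex_of_real A"
  have C: "?C \<in> carrier_mat n n" using A by simp
  obtain k where "eigenvalue ?C k"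
    using spectrum_non_empty[OF C] \<open>0 < n\<close> by (auto simp: spectrum_def)
  then obtain v where kv: "eigenvector ?C v k"
    by (auto simp: eigenvalue_def)
  then have v: "v \<in> carrier_vec n" "v \<noteq> 0\<^sub>v n"
    using C by (auto simp: eigenvector_def)
  have eq: "(\<Sum>j<n. of_real (A $$ (i, j)) * v $ j) = k * v $ i" if "i < n" for i
    using eigenvector_component[OF C kv that] that A by simp
  define N where "N = (\<Sum>i<n. (cmod (v $ i))\<^sup>2)"
  define q where "q = (\<Sum>i<n. \<Sum>j<n. cnj (v $ i) * (of_real (A $$ (i, j)) * v $ j))"
  have "q = (\<Sum>i<n. cnj (v $ i) * (k * v $ i))"
    unfolding q_def sum_distrib_left[symmetric] by (intro sum.cong refl) (simp add: eq)
  also have "\<dots> = k * of_real N"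
    unfolding N_def of_real_sum sum_distrib_left
    by (intro sum.cong refl) (simp only: complex_norm_square, simp add: mult_ac)
  finally have q: "q = k * of_real N" .
  \<comment> \<open>Conjugation exchanges the roles of \<open>i\<close> and \<open>j\<close>, so by
    symmetry the quadratic form \<open>q\<close> is real, and hence so is \<open>k\<close>.\<close>
  have "cnj q = (\<Sum>i<n. \<Sum>j<n. cnj (v $ j) * (of_real (A $$ (j, i)) * v $ i))"
    unfolding q_def cnj_sum by (intro sum.cong refl) (simp add: sym mult_ac)
  also have "\<dots> = q"
    unfolding q_def by (rule sum.swap)
  finally have "cnj k * of_real N = k * of_real N"
    by (simp add: q)
  moreover have "N \<noteq> 0"
  proof
    assume "N = 0"
    then have "\<forall>i<n. v $ i = 0"
      by (simp add: N_def sum_nonneg_eq_0_iff)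
    with v(1) have "v = 0\<^sub>v n" by auto
    with v(2) show False ..
  qed
  ultimately have "cnj k = k" by simp
  then have k: "k = of_real (Re k)"
    by (simp add: complex_eq_iff)
  have "poly (map_poly of_real (char_poly A)) k = 0"
    using \<open>eigenvalue ?C k\<close> eigenvalue_root_char_poly[OF C] of_real_hom.char_poly_hom[OF A, where ?'a = complex]
    by simp
  then have "poly (char_poly A) (Re k) = 0"
    by (subst (asm) k) (simp add: of_real_hom.poly_map_poly)
  then show ?thesis
    using spectrum_root_char_poly[OF A] by auto
qed

text \<open>The triangle inequality applied to the eigenvalue equation yields the inequality for the
  absolute values of an eigenvector, because the matrix entries and the eigenvalue are
  nonnegative.\<close>

lemma largest_eigenvalue_subsolution:
  assumes G: "pair_graph G" and "pverts G \<noteq> {}" and "0 \<le> largest_eigenvalue G"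
  shows "\<exists>x. (\<exists>p\<in>pverts G. x p = 1) \<and> (\<forall>v\<in>pverts G. 0 \<le> x v \<and> x v \<le> 1 \<and>
    largest_eigenvalue G * x v \<le> (\<Sum>u | u \<in> pverts G \<and> (v, u) \<in> parcs G. x u))"
proof -
  interpret pair_graph G by fact
  define vs where "vs = (SOME vs. distinct vs \<and> set vs = pverts G)"
  have "\<exists>vs. distinct vs \<and> set vs = pverts G"
    using finite_distinct_list[OF pair_finite_verts] by blast
  then have "distinct vs \<and> set vs = pverts G"
    unfolding vs_def by (rule someI_ex)
  then have vs: "distinct vs" "set vs = pverts G" by simp_all
  define n where "n = length vs"
  define A :: "real mat" where
    "A = mat n n (\<lambda>(i, j). if (vs ! i, vs ! j) \<in> parcs G then 1 else 0)"
  have adj: "adjacency_matrix G = A"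
    by (simp add: adjacency_matrix_def vs_def A_def n_def Let_def)
  have A: "A \<in> carrier_mat n n" by (simp add: A_def)
  have n: "0 < n" using vs \<open>pverts G \<noteq> {}\<close> by (auto simp: n_def)
  define l where "l = largest_eigenvalue G"
  have "spectrum A \<noteq> {}"
    using A n by (rule real_symmetric_spectrum_nonempty)
      (use pair_sym_arcs in \<open>auto simp: A_def symmetric_def dest: symD\<close>)
  then have "l \<in> spectrum A"
    unfolding l_def largest_eigenvalue_def adj using card_finite_spectrum(1)[OF A] by (rule Max_in[rotated])
  then obtain y where ly: "eigenvector A y l"
    by (auto simp: spectrum_def eigenvalue_def)
  then have y: "y \<in> carrier_vec n" "y \<noteq> 0\<^sub>v n"
    using A by (auto simp: eigenvector_def)
  have bij: "bij_betw ((!) vs) {..<n} (pverts G)"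
    using vs bij_betw_nth by (metis n_def)
  define z where "z v = \<bar>y $ (the_inv_into {..<n} ((!) vs) v)\<bar>" for v
  have z: "z (vs ! i) = \<bar>y $ i\<bar>" if "i < n" for i
    using that bij by (simp add: z_def the_inv_into_f_f bij_betw_def)
  have z_le: "l * z v \<le> (\<Sum>u | u \<in> pverts G \<and> (v, u) \<in> parcs G. z u)" if v: "v \<in> pverts G" for v
  proof -
    obtain i where i: "i < n" "v = vs ! i"
      using v bij_betw_imp_surj_on[OF bij] by blast
    have "l * z v = \<bar>l * y $ i\<bar>"
      unfolding i(2) z[OF i(1)] abs_mult using assms(3) by (simp add: l_def)
    also have "\<dots> = \<bar>\<Sum>j<n. A $$ (i, j) * y $ j\<bar>"
      by (simp only: eigenvector_component[OF A ly i(1)])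
    also have "\<dots> \<le> (\<Sum>j<n. \<bar>A $$ (i, j) * y $ j\<bar>)" by (rule sum_abs)
    also have "\<dots> = (\<Sum>j<n. if (v, vs ! j) \<in> parcs G then z (vs ! j) else 0)"
      by (intro sum.cong refl) (use i z in \<open>auto simp: A_def\<close>)
    also have "\<dots> = (\<Sum>u\<in>pverts G. if (v, u) \<in> parcs G then z u else 0)"
      using bij by (rule sum.reindex_bij_betw)
    also have "\<dots> = (\<Sum>u | u \<in> pverts G \<and> (v, u) \<in> parcs G. z u)"
      by (rule sum.inter_filter[OF pair_finite_verts, symmetric])
    finally show ?thesis .
  qed
  \<comment> \<open>Scaling by the maximum puts the weights into the unit interval and produces a
    vertex of weight 1. It is positive because \<open>y\<close> is nonzero.\<close>
  define Z where "Z = Max (z ` pverts G)"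
  have "Z \<in> z ` pverts G"
    unfolding Z_def using pair_finite_verts \<open>pverts G \<noteq> {}\<close> by (intro Max_in) auto
  then obtain p where p: "p \<in> pverts G" "z p = Z" by auto
  have z_Z: "z v \<le> Z" if "v \<in> pverts G" for v
    unfolding Z_def using pair_finite_verts that by simp
  have "0 < Z"
  proof -
    obtain i where i: "i < n" "y $ i \<noteq> 0"
      using y eq_vecI[of y "0\<^sub>v n"] by auto
    then have "vs ! i \<in> pverts G" using bij_betw_apply[OF bij] by simp
    then have "z (vs ! i) \<le> Z" by (rule z_Z)
    with i z show ?thesis by simp
  qed
  have z0: "0 \<le> z v" for v by (simp add: z_def)
  show ?thesis
  proof (intro exI[of _ "\<lambda>v. z v / Z"] conjI ballI bexI[of _ p])
    fix v assume v: "v \<in> pverts G"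
    show "0 \<le> z v / Z" "z v / Z \<le> 1"
      using z0[of v] z_Z[OF v] \<open>0 < Z\<close> by simp_all
    show "largest_eigenvalue G * (z v / Z)
        \<le> (\<Sum>u | u \<in> pverts G \<and> (v, u) \<in> parcs G. z u / Z)"
      using divide_right_mono[OF z_le[OF v], of Z] \<open>0 < Z\<close>
      by (simp add: l_def sum_divide_distrib)
  qed (use p \<open>0 < Z\<close> in auto)
qed

section \<open>Induced complete bipartite subgraphs\<close>

theorem theorem1:
  fixes s t n :: nat
    and K :: real
    and H :: "'b pair_pre_digraph"
    and G :: "'a pair_pre_digraph"
  assumes "3 \<le> s" and "s \<le> t"
    and "pair_graph H"
    and "K \<ge> real (ramsey_number H (complete_graph t)) powr (2 / real s)
               * real (ramsey_number H (complete_graph s))"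
    and "pair_graph G"
    and "card (pverts G) = n" and "n \<ge> 1"
    and "free_of H G"
    and "largest_eigenvalue G \<ge> K * real n powr (1 - 1 / real s)"
  shows "contains_induced_complete_bipartite s t G"
proof -
  define r where "r = ramsey_number H (complete_graph t)"
  define m where "m = ramsey_number H (complete_graph s)"
  define l where "l = largest_eigenvalue G"
  define V where "V = pverts G"
  define N where "N v = {u. u \<in> V \<and> (v, u) \<in> parcs G}" for v
  define F where "F = {S. S \<subseteq> V \<and> card S = s \<and> (\<forall>u\<in>S. \<forall>v\<in>S. (u, v) \<notin> parcs G)}"
  note G = pair_graphD[OF \<open>pair_graph G\<close>]
  have fin: "finite V" and cardV: "card V = n"
    using G(1) assms by (auto simp: V_def)
  have indep: "\<exists>T. T \<subseteq> U \<and> card T = k \<and> (\<forall>u\<in>T. \<forall>v\<in>T. (u, v) \<notin> parcs G)"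
    if "U \<subseteq> V" "card U = ramsey_number H (complete_graph k)" for U k
    using independent_set_of_ramsey_number[OF assms(3,5,8)] that by (simp add: V_def)
  \<comment> \<open>A Ramsey number of at most 1 would be at most \<open>n\<close>, so some set of
    that many vertices of the \<open>H\<close>-free graph \<open>G\<close> would contain an
    independent \<open>k\<close>-set, which is larger.\<close>
  have ramsey_ge: "2 \<le> ramsey_number H (complete_graph k)" if "2 \<le> k" for k
  proof (rule ccontr)
    assume "\<not> ?thesis"
    then have "ramsey_number H (complete_graph k) \<le> card V"
      using cardV \<open>n \<ge> 1\<close> by linarith
    then obtain U where U: "U \<subseteq> V" "card U = ramsey_number H (complete_graph k)" "finite U"
      by (rule obtain_subset_with_card_n)
    then obtain T where "T \<subseteq> U" "card T = k" using indep by blast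
    then have "k \<le> card U" using card_mono[OF U(3)] by blast
    with U(2) that \<open>\<not> ?thesis\<close> show False by linarith
  qed
  have r: "2 \<le> r" and m: "2 \<le> m"
    using assms(1,2) ramsey_ge by (auto simp: r_def m_def)
  \<comment> \<open>The eigenvalue bound for the smallest admissible \<open>K\<close>. Its
    \<open>s\<close>-th power is free of real exponents and is exactly the left-hand side of
    \<open>big\<close>.\<close>
  define b where "b = real r powr (2 / real s) * real m * real n powr (1 - 1 / real s)"
  have "b \<le> K * real n powr (1 - 1 / real s)"
    using assms(4) unfolding b_def r_def m_def by (rule mult_right_mono) simp
  then have bl: "b \<le> l" using assms(9) by (simp add: l_def)
  have "0 \<le> b" by (simp add: b_def)
  have "(real r powr (2 / real s)) ^ s = real r ^ 2"
  proof -
    have "(real r powr (2 / real s)) ^ s = real r powr (2 / real s * real s)"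
      using r by (subst powr_powr[symmetric], subst powr_realpow) auto
    also have "2 / real s * real s = 2" using \<open>3 \<le> s\<close> by simp
    finally show ?thesis using r by simp
  qed
  moreover have "(real n powr (1 - 1 / real s)) ^ s = real n ^ (s - 1)"
  proof -
    have "(real n powr (1 - 1 / real s)) ^ s = real n powr ((1 - 1 / real s) * real s)"
      using \<open>n \<ge> 1\<close> by (subst powr_powr[symmetric], subst powr_realpow) auto
    also have "(1 - 1 / real s) * real s = real (s - 1)"
      using \<open>3 \<le> s\<close> by (simp add: left_diff_distrib)
    also have "real n powr real (s - 1) = real n ^ (s - 1)"
      using \<open>n \<ge> 1\<close> by (intro powr_realpow) simp
    finally show ?thesis .
  qed
  ultimately have "b ^ s = real m ^ s * real r ^ 2 * real (card V) ^ (s - 1)"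
    by (simp add: b_def power_mult_distrib cardV)
  then have big: "real m ^ s * real r ^ 2 * real (card V) ^ (s - 1) \<le> l ^ s"
    using power_mono[OF bl \<open>0 \<le> b\<close>, of s] by simp
  have "V \<noteq> {}" using cardV \<open>n \<ge> 1\<close> by auto
  have "0 \<le> l" using bl \<open>0 \<le> b\<close> by simp
  obtain x p where x: "\<And>v. v \<in> V \<Longrightarrow> 0 \<le> x v \<and> x v \<le> 1" "p \<in> V" "x p = 1"
      "\<And>v. v \<in> V \<Longrightarrow> l * x v \<le> (\<Sum>u\<in>N v. x u)"
    using largest_eigenvalue_subsolution[OF \<open>pair_graph G\<close>] \<open>V \<noteq> {}\<close> \<open>0 \<le> l\<close>
    unfolding V_def l_def N_def by blast
  have "\<exists>S\<in>F. r \<le> card {v \<in> V. S \<subseteq> N v}"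
  proof (rule exists_common_neighbours[where p = p and l = l and s = s and m = m and x = x])
    show "l * x v \<le> (\<Sum>u\<in>N v. x u)" if "v \<in> V" for v using x(4) that .
    show "\<exists>S\<in>F. S \<subseteq> M" if "M \<subseteq> V" "card M = m" for M
      using indep[of M s] that unfolding m_def F_def by blast
  qed (use fin x(1-3) big r m \<open>3 \<le> s\<close> \<open>0 \<le> l\<close> in \<open>auto simp: N_def F_def\<close>)
  then obtain S where S: "S \<in> F" "r \<le> card {v \<in> V. S \<subseteq> N v}" by blast
  \<comment> \<open>Exactly \<open>r\<close> common neighbours are kept, so that the Ramsey property
    yields the independent \<open>t\<close>-side inside \<open>U\<close>.\<close>
  obtain U where U: "U \<subseteq> {v \<in> V. S \<subseteq> N v}" "card U = r"
    using obtain_subset_with_card_n[OF S(2)] by blast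
  then obtain T where T: "T \<subseteq> U" "card T = t" "\<forall>u\<in>T. \<forall>v\<in>T. (u, v) \<notin> parcs G"
    using indep[of U t] by (auto simp: r_def)
  show ?thesis
  proof (rule contains_induced_complete_bipartiteI[OF \<open>pair_graph G\<close>])
    show "\<forall>u\<in>S. \<forall>v\<in>T. (u, v) \<in> parcs G"
      using T(1) U(1) G(3) by (auto simp: N_def dest: symD)
  qed (use S(1) T U(1) in \<open>auto simp: F_def V_def\<close>)
qed

end
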